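(* Let $X,Z$ be real separated (Hausdorff) locally convex spaces, $C\subseteq Z$ a nonempty convex cone, $S\subseteq X$ a nonempty set, and $f:X\to\overline{\mathbb R}$, $g:X\to Z^\bullet$ proper functions such that $v(P_L)\in\mathbb R$ and $(f,g)$ is convexlike on $\operatorname{dom}f\cap S\cap\operatorname{dom}g$ with respect to the cone $\mathbb R_+\times C$ (the latter is the case if, for instance, $S$ is a convex set, $f$ is a convex function and $g$ is a $C$-convex function). Put $G:=g(\operatorname{dom}f\cap S\cap\operatorname{dom}g)+C$. Suppose that one of the following conditions holds: (RC6') there exists $x'\in\operatorname{dom}f\cap S$ such that $g(x')\in-\operatorname{qri}(C)$, $\operatorname{cl}(C-C)=Z$ and $(0,0)\notin\operatorname{qri}[\operatorname{co}(\mathcal E\cup\{(0,0)\})]$; (RC6) $0\in\operatorname{qi}(G)$ and $(0,0)\notin\operatorname{qri}[\operatorname{co}(\mathcal E\cup\{(0,0)\})]$; (RC7) $0\in\operatorname{qi}(G-G)$, $0\in\operatorname{qri}(G)$ and $(0,0)\notin\operatorname{qri}[\operatorname{co}(\mathcal E\cup\{(0,0)\})]$. Then $v(P_L)=v(D_L)$ and $(D_L)$ has an optimal solution.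
   Context: $\overline{\mathbb R}=\mathbb R\cup\{\pm\infty\}$. A convex cone $C$ satisfies $\operatorname{cone}(C)\subseteq C$ and $C+C\subseteq C$, where $\operatorname{cone}(U)=\bigcup_{t\ge0}tU$. $C$ induces $z_1\le_C z_2\iff z_2-z_1\in C$. $Z^\bullet=Z\cup\{\infty_C\}$ with $\infty_C$ an abstract greatest element for $\le_C$, and $z+\infty_C=\infty_C+z=\infty_C$, $t\,\infty_C=\infty_C$ for all $z\in Z^\bullet$, $t\ge0$. $C^*=\{z^*\in Z^*:\langle z^*,z\rangle\ge0\ \forall z\in C\}$ ($Z^*$ the topological dual) and $\langle z^*,\infty_C\rangle=+\infty$ for $z^*\in C^*$. $\operatorname{dom}f=\{x:f(x)<+\infty\}$; $f$ is proper if $\operatorname{dom}f\ne\emptyset$ and $f>-\infty$ everywhere. $\operatorname{dom}g=\{x:g(x)\in Z\}$; $g$ is proper if $\operatorname{dom}g\neq\emptyset$; $g$ is $C$-convex if $g(tx+(1-t)y)\le_C tg(x)+(1-t)g(y)$ for all $x,y\in X$, $t\in[0,1]$. Primal problem $(P_L)$: $\inf\{f(x):x\in S,\ g(x)\in-C\}$, with value $v(P_L)$. Lagrange dual $(D_L)$: $\sup_{z^*\in C^*}\inf_{x\in S}\{f(x)+\langle z^*,g(x)\rangle\}$, with value $v(D_L)$; an optimal solution is a $z^*\in C^*$ attaining the supremum. $(f,g)$ is convexlike on $\operatorname{dom}f\cap S\cap\operatorname{dom}g$ with respect to $\mathbb R_+\times C$ if the set $\{(f(x),g(x)):x\in\operatorname{dom}f\cap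 S\cap\operatorname{dom}g\}+\mathbb R_+\times C$ is convex. $\mathcal E:=\{(g(x)+z,\ f(x)-v(P_L)+\varepsilon):x\in\operatorname{dom}f\cap S\cap\operatorname{dom}g,\ z\in C,\ \varepsilon\ge0\}\subseteq Z\times\mathbb R$. For a nonempty convex subset $U$ of a separated locally convex space $V$: $\operatorname{qi}(U)=\{u\in U:\operatorname{cl}(\operatorname{cone}(U-u))=V\}$ (quasi interior); $\operatorname{qri}(U)=\{u\in U:\operatorname{cl}(\operatorname{cone}(U-u))\text{ is a linear subspace of }V\}$ (quasi-relative interior). $\operatorname{co}$ is the convex hull, $\operatorname{cl}$ the closure. *)

theory Defs
  imports "HOL-Analysis.Analysis"
begin

section \<open>Separated locally convex spaces\<close>

text \<open>Library constants such as \<^const>\<open>convex\<close> cannot occur in a class specification (they carry a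
  sort constraint), so convexity of \<open>V\<close> is written out as in \<open>convex_def\<close>.\<close>

class locally_convex_space = real_vector + topological_ab_group_add + t2_space +
  assumes tendsto_scaleR_Pair_lcs:
      "LIM p (nhds (c::real) \<times>\<^sub>F nhds x). fst p *\<^sub>R snd p :> nhds (c *\<^sub>R x)"
    and convex_neighbourhood_base_0:
      "open U \<Longrightarrow> 0 \<in> U \<Longrightarrow> \<exists>V. open V \<and> 0 \<in> V \<and>
        (\<forall>x\<in>V. \<forall>y\<in>V. \<forall>u\<ge>0. \<forall>v\<ge>0. u + v = 1 \<longrightarrow> u *\<^sub>R x + v *\<^sub>R y \<in> V) \<and> V \<subseteq> U"

lemmas convex_neighbourhood_base = convex_neighbourhood_base_0[folded convex_def]

instance real_normed_vector < locally_convex_space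
proof
  fix c :: real and x :: 'a
  show "LIM p (nhds c \<times>\<^sub>F nhds x). fst p *\<^sub>R snd p :> nhds (c *\<^sub>R x)"
    by (intro tendsto_scaleR filterlim_fst filterlim_snd)
next
  fix U :: "'a set"
  assume "open U" "0 \<in> U"
  then obtain e where "e > 0" "ball 0 e \<subseteq> U"
    by (meson open_contains_ball)
  then show "\<exists>V. open V \<and> 0 \<in> V \<and>
      (\<forall>x\<in>V. \<forall>y\<in>V. \<forall>u\<ge>0. \<forall>v\<ge>0. u + v = 1 \<longrightarrow> u *\<^sub>R x + v *\<^sub>R y \<in> V) \<and> V \<subseteq> U"
    unfolding convex_def[symmetric]
    by (intro exI[of _ "ball 0 e"]) auto
qed

instance prod :: (topological_monoid_add, topological_monoid_add) topological_monoid_add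
proof
  fix x y :: "'a \<times> 'b"
  have "((\<lambda>p. (fst (fst p) + fst (snd p), snd (fst p) + snd (snd p))) \<longlongrightarrow>
      (fst x + fst y, snd x + snd y)) (nhds x \<times>\<^sub>F nhds y)"
    by (intro tendsto_Pair tendsto_add tendsto_fst tendsto_snd filterlim_fst filterlim_snd)
  then show "LIM p (nhds x \<times>\<^sub>F nhds y). fst p + snd p :> nhds (x + y)"
    by (simp add: plus_prod_def)
qed

instance prod :: (topological_comm_monoid_add, topological_comm_monoid_add)
  topological_comm_monoid_add ..

instance prod :: (topological_group_add, topological_group_add) topological_group_add
proof
  fix x :: "'a \<times> 'b"
  have "((\<lambda>p. (- fst p, - snd p)) \<longlongrightarrow> (- fst x, - snd x)) (nhds x)"
    by (intro tendsto_Pair tendsto_minus tendsto_fst tendsto_snd filterlim_ident)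
  then show "LIM y nhds x. - y :> nhds (- x)"
    by (simp add: uminus_prod_def)
qed

instance prod :: (topological_ab_group_add, topological_ab_group_add) topological_ab_group_add ..

instance prod :: (locally_convex_space, locally_convex_space) locally_convex_space
proof
  fix c :: real and x :: "'a \<times> 'b"
  obtain a b where x: "x = (a, b)" by force
  have fst: "LIM p (nhds c \<times>\<^sub>F nhds x). (fst p, fst (snd p)) :> nhds c \<times>\<^sub>F nhds a"
    using filterlim_snd[of "nhds x" "nhds c"] x
    by (intro filterlim_Pair filterlim_fst) (auto dest: tendsto_fst)
  have snd: "LIM p (nhds c \<times>\<^sub>F nhds x). (fst p, snd (snd p)) :> nhds c \<times>\<^sub>F nhds b"
    using filterlim_snd[of "nhds x" "nhds c"] x
    by (intro filterlim_Pair filterlim_fst) (auto dest: tendsto_snd)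
  have "((\<lambda>p. (fst p *\<^sub>R fst (snd p), fst p *\<^sub>R snd (snd p))) \<longlongrightarrow> (c *\<^sub>R a, c *\<^sub>R b))
      (nhds c \<times>\<^sub>F nhds x)"
    using filterlim_compose[OF tendsto_scaleR_Pair_lcs fst]
      filterlim_compose[OF tendsto_scaleR_Pair_lcs snd]
    by (intro tendsto_Pair) simp_all
  moreover have "(\<lambda>p::real \<times> ('a \<times> 'b). (fst p *\<^sub>R fst (snd p), fst p *\<^sub>R snd (snd p))) =
      (\<lambda>p. fst p *\<^sub>R snd p)"
    by (auto simp: fun_eq_iff prod_eq_iff)
  ultimately show "LIM p (nhds c \<times>\<^sub>F nhds x). fst p *\<^sub>R snd p :> nhds (c *\<^sub>R x)"
    by (simp add: x)
next
  fix U :: "('a \<times> 'b) set"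
  assume "open U" "0 \<in> U"
  then obtain A B where "open A" "open B" "(0, 0) \<in> A \<times> B" and U: "A \<times> B \<subseteq> U"
    by (metis open_prod_elim zero_prod_def)
  then obtain V W where "open V" "0 \<in> V" "convex V" "V \<subseteq> A" "open W" "0 \<in> W" "convex W" "W \<subseteq> B"
    by (metis SigmaE2 convex_neighbourhood_base)
  then show "\<exists>V. open V \<and> 0 \<in> V \<and>
      (\<forall>x\<in>V. \<forall>y\<in>V. \<forall>u\<ge>0. \<forall>v\<ge>0. u + v = 1 \<longrightarrow> u *\<^sub>R x + v *\<^sub>R y \<in> V) \<and> V \<subseteq> U"
    unfolding convex_def[symmetric]
    using U by (intro exI[of _ "V \<times> W"])
      (auto simp: open_Times convex_Times zero_prod_def)
qed

definition topological_dual :: "('z::locally_convex_space \<Rightarrow> real) set"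
  where "topological_dual = {\<phi>. linear \<phi> \<and> continuous_on UNIV \<phi>}"

text \<open>Sums of sets are Minkowski sums (\<^theory>\<open>HOL-Library.Set_Algebras\<close>), but the minus sign on
  sets is the set-theoretic difference, so Minkowski differences need their own name.\<close>

definition minkowski_diff :: "'a::real_vector set \<Rightarrow> 'a set \<Rightarrow> 'a set"
  where "minkowski_diff A B = {a - b |a b. a \<in> A \<and> b \<in> B}"

text \<open>The set \<open>conic hull U\<close> is \<open>\<Union>t\<ge>0. t U\<close>; see the lemma \<open>conic_hull_explicit\<close>.\<close>

definition quasi_interior :: "'a::locally_convex_space set \<Rightarrow> 'a set"
  where "quasi_interior U = {u \<in> U. closure (conic hull ((\<lambda>v. v - u) ` U)) = UNIV}"

definition quasi_relative_interior :: "'a::locally_convex_space set \<Rightarrow> 'a set"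
  where "quasi_relative_interior U =
    {u \<in> U. subspace (closure (conic hull ((\<lambda>v. v - u) ` U)))}"


section \<open>Adjoining a greatest element to the ordered space\<close>

datatype 'z bullet = Elem 'z | Infty

text \<open>Scalar multiplication on \<^typ>\<open>'z bullet\<close> is only meant for nonnegative scalars; in particular
  \<open>0 *\<^sub>R Infty = Infty\<close>.\<close>

instantiation bullet :: (plus) plus
begin

fun plus_bullet :: "'a bullet \<Rightarrow> 'a bullet \<Rightarrow> 'a bullet" where
  "plus_bullet (Elem a) (Elem b) = Elem (a + b)"
| "plus_bullet _ _ = Infty"

instance ..

end

instantiation bullet :: (scaleR) scaleR
begin

fun scaleR_bullet :: "real \<Rightarrow> 'a bullet \<Rightarrow> 'a bullet" where
  "scaleR_bullet t (Elem a) = Elem (t *\<^sub>R a)"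
| "scaleR_bullet t Infty = Infty"

instance ..

end

fun cone_le :: "'z::real_vector set \<Rightarrow> 'z bullet \<Rightarrow> 'z bullet \<Rightarrow> bool" where
  "cone_le C _ Infty \<longleftrightarrow> True"
| "cone_le C (Elem a) (Elem b) \<longleftrightarrow> b - a \<in> C"
| "cone_le C Infty (Elem b) \<longleftrightarrow> False"

definition dual_cone :: "'z::locally_convex_space set \<Rightarrow> ('z \<Rightarrow> real) set"
  where "dual_cone C = {\<phi> \<in> topological_dual. \<forall>z\<in>C. 0 \<le> \<phi> z}"

fun pairing :: "('z \<Rightarrow> real) \<Rightarrow> 'z bullet \<Rightarrow> ereal" where
  "pairing \<phi> (Elem z) = ereal (\<phi> z)"
| "pairing \<phi> Infty = \<infinity>"


section \<open>Domains, properness and convexity\<close>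

definition edom :: "('x \<Rightarrow> ereal) \<Rightarrow> 'x set"
  where "edom f = {x. f x < \<infinity>}"

definition eproper :: "('x \<Rightarrow> ereal) \<Rightarrow> bool"
  where "eproper f \<longleftrightarrow> edom f \<noteq> {} \<and> (\<forall>x. - \<infinity> < f x)"

definition econvex :: "('x::real_vector \<Rightarrow> ereal) \<Rightarrow> bool"
  where "econvex f \<longleftrightarrow> (\<forall>x y. \<forall>t\<in>{0..1}.
    f (t *\<^sub>R x + (1 - t) *\<^sub>R y) \<le> ereal t * f x + ereal (1 - t) * f y)"

definition bdom :: "('x \<Rightarrow> 'z bullet) \<Rightarrow> 'x set"
  where "bdom g = {x. g x \<in> range Elem}"

definition bproper :: "('x \<Rightarrow> 'z bullet) \<Rightarrow> bool"
  where "bproper g \<longleftrightarrow> bdom g \<noteq> {}"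

definition cone_convex :: "'z::real_vector set \<Rightarrow> ('x::real_vector \<Rightarrow> 'z bullet) \<Rightarrow> bool"
  where "cone_convex C g \<longleftrightarrow> (\<forall>x y. \<forall>t\<in>{0..1}.
    cone_le C (g (t *\<^sub>R x + (1 - t) *\<^sub>R y)) (t *\<^sub>R g x + (1 - t) *\<^sub>R g y))"

text \<open>In the sets below \<open>g x = Elem y\<close> both restricts \<open>x\<close> to \<^term>\<open>bdom g\<close> and names the value.
  The value \<open>f x\<close> is finite there whenever \<open>f\<close> is proper, so \<^const>\<open>real_of_ereal\<close> loses nothing.\<close>

definition convexlike ::
    "('x \<Rightarrow> ereal) \<Rightarrow> ('x \<Rightarrow> 'z::real_vector bullet) \<Rightarrow> 'x set \<Rightarrow> 'z set \<Rightarrow> bool"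
  where "convexlike f g S C \<longleftrightarrow>
    convex ({(real_of_ereal (f x), y) |x y. x \<in> edom f \<inter> S \<and> g x = Elem y} + {0..} \<times> C)"

definition image_plus_cone ::
    "('x \<Rightarrow> ereal) \<Rightarrow> ('x \<Rightarrow> 'z::real_vector bullet) \<Rightarrow> 'x set \<Rightarrow> 'z set \<Rightarrow> 'z set"
  where "image_plus_cone f g S C = {y. \<exists>x\<in>edom f \<inter> S. g x = Elem y} + C"


section \<open>The primal problem and its Lagrange dual\<close>

definition primal_value ::
    "('x \<Rightarrow> ereal) \<Rightarrow> ('x \<Rightarrow> 'z::real_vector bullet) \<Rightarrow> 'x set \<Rightarrow> 'z set \<Rightarrow> ereal"
  where "primal_value f g S C = (INF x\<in>{x \<in> S. g x \<in> Elem ` uminus ` C}. f x)"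

definition dual_objective ::
    "('x \<Rightarrow> ereal) \<Rightarrow> ('x \<Rightarrow> 'z bullet) \<Rightarrow> 'x set \<Rightarrow> ('z \<Rightarrow> real) \<Rightarrow> ereal"
  where "dual_objective f g S \<phi> = (INF x\<in>S. f x + pairing \<phi> (g x))"

definition dual_value ::
    "('x \<Rightarrow> ereal) \<Rightarrow> ('x \<Rightarrow> 'z::locally_convex_space bullet) \<Rightarrow> 'x set \<Rightarrow> 'z set \<Rightarrow> ereal"
  where "dual_value f g S C = (SUP \<phi>\<in>dual_cone C. dual_objective f g S \<phi>)"

definition dual_solution ::
    "('x \<Rightarrow> ereal) \<Rightarrow> ('x \<Rightarrow> 'z::locally_convex_space bullet) \<Rightarrow> 'x set \<Rightarrow> 'z set \<Rightarrow>
      ('z \<Rightarrow> real) \<Rightarrow> bool"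
  where "dual_solution f g S C \<phi> \<longleftrightarrow>
    \<phi> \<in> dual_cone C \<and> dual_objective f g S \<phi> = dual_value f g S C"

text \<open>Only meaningful when \<^const>\<open>primal_value\<close> is finite.\<close>

definition conic_extension ::
    "('x \<Rightarrow> ereal) \<Rightarrow> ('x \<Rightarrow> 'z::real_vector bullet) \<Rightarrow> 'x set \<Rightarrow> 'z set \<Rightarrow> ('z \<times> real) set"
  where "conic_extension f g S C =
    {(y + z, real_of_ereal (f x) - real_of_ereal (primal_value f g S C) + \<epsilon>) |x y z \<epsilon>.
      x \<in> edom f \<inter> S \<and> g x = Elem y \<and> z \<in> C \<and> 0 \<le> \<epsilon>}"


section \<open>Regularity conditions\<close>

definition qri_separation ::
    "('x \<Rightarrow> ereal) \<Rightarrow> ('x \<Rightarrow> 'z::locally_convex_space bullet) \<Rightarrow> 'x set \<Rightarrow> 'z set \<Rightarrow> bool"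
  where "qri_separation f g S C \<longleftrightarrow>
    (0, 0) \<notin> quasi_relative_interior (convex hull (conic_extension f g S C \<union> {(0, 0)}))"

definition RC6' ::
    "('x \<Rightarrow> ereal) \<Rightarrow> ('x \<Rightarrow> 'z::locally_convex_space bullet) \<Rightarrow> 'x set \<Rightarrow> 'z set \<Rightarrow> bool"
  where "RC6' f g S C \<longleftrightarrow>
    (\<exists>x'\<in>edom f \<inter> S. g x' \<in> Elem ` uminus ` quasi_relative_interior C) \<and>
    closure (minkowski_diff C C) = UNIV \<and> qri_separation f g S C"

definition RC6 ::
    "('x \<Rightarrow> ereal) \<Rightarrow> ('x \<Rightarrow> 'z::locally_convex_space bullet) \<Rightarrow> 'x set \<Rightarrow> 'z set \<Rightarrow> bool"
  where "RC6 f g S C \<longleftrightarrow>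
    0 \<in> quasi_interior (image_plus_cone f g S C) \<and> qri_separation f g S C"

definition RC7 ::
    "('x \<Rightarrow> ereal) \<Rightarrow> ('x \<Rightarrow> 'z::locally_convex_space bullet) \<Rightarrow> 'x set \<Rightarrow> 'z set \<Rightarrow> bool"
  where "RC7 f g S C \<longleftrightarrow>
    0 \<in> quasi_interior (minkowski_diff (image_plus_cone f g S C) (image_plus_cone f g S C)) \<and>
    0 \<in> quasi_relative_interior (image_plus_cone f g S C) \<and> qri_separation f g S C"

end

theory Submission
  imports Defs
begin

text \<open>
  Let \<open>v\<close> be the finite primal value and let \<open>K\<close> be the convex cone generated by the set \<open>E\<close> of all
  points \<open>(g x + z, f x - v + \<epsilon>)\<close>. A multiplier with dual value at least \<open>v\<close> is the same as a
  continuous functional \<open>(\<phi>, 1)\<close> on \<open>Z \<times> \<real>\<close> which is nonnegative on \<open>E\<close>; weak duality gives the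
  converse inequality, so such a functional solves the dual problem and closes the gap.

  The hypothesis that the origin is not in the quasi-relative interior of \<open>co (E \<union> {0})\<close> says that
  the closure of \<open>K\<close> is not a linear subspace. By Hahn-Banach the closure of \<open>K\<close> is the
  intersection of the half-spaces \<open>{0 \<le> \<psi>}\<close> containing \<open>K\<close>; if each of these \<open>\<psi>\<close> vanished on \<open>K\<close>,
  this would be an intersection of kernels, hence a subspace. So some continuous \<open>\<psi> = (\<phi>, r)\<close> is
  nonnegative on \<open>E\<close> and positive somewhere on \<open>E\<close>
  (\<open>nonneg_functional_of_not_subspace_closure\<close>). Enlarging \<open>\<epsilon>\<close> and
  the cone part shows \<open>r \<ge> 0\<close> and \<open>\<phi> \<in> C\<^sup>*\<close>. If \<open>r > 0\<close>, then \<open>\<phi> / r\<close> is the multiplier sought. If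
  \<open>r = 0\<close>, then \<open>\<phi>\<close> is nonnegative and somewhere positive on \<open>G = g (dom f \<inter> S \<inter> dom g) + C\<close>. Each of
  the three interiority conditions forbids this, for one reason: a continuous functional that is
  nonnegative on a set whose generated cone has a subspace as closure vanishes on that set
  (\<open>dual_eq_0_of_subspace_closure\<close>).

  The Hahn-Banach theorem in the form needed here separates a point from the closure of a convex
  cone. A cone \<open>M\<close> that is maximal among those containing \<open>K\<close> and missing a convex open cone \<open>P\<close>
  around the point is a closed half-space: it satisfies \<open>M \<union> - M = UNIV\<close>, so its boundary
  \<open>M \<inter> - M\<close> is a closed hyperplane, and the functional can be read off from it.
\<close>

section \<open>Continuity in separated locally convex spaces\<close>

lemma tendsto_scaleR_lcs:
  fixes b :: "'a::locally_convex_space"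
  assumes "(f \<longlongrightarrow> a) F" and "(h \<longlongrightarrow> b) F"
  shows "((\<lambda>x. f x *\<^sub>R h x) \<longlongrightarrow> a *\<^sub>R b) F"
  using filterlim_compose[OF tendsto_scaleR_Pair_lcs filterlim_Pair[OF assms]] by simp

lemma continuous_on_scaleR_lcs:
  fixes h :: "'b::topological_space \<Rightarrow> 'a::locally_convex_space"
  assumes "continuous_on A f" and "continuous_on A h"
  shows "continuous_on A (\<lambda>x. f x *\<^sub>R h x)"
  using assms unfolding continuous_on_def by (auto intro: tendsto_scaleR_lcs)

lemma continuous_on_add_lcs:
  fixes f h :: "'b::topological_space \<Rightarrow> 'a::locally_convex_space"
  assumes "continuous_on A f" and "continuous_on A h"
  shows "continuous_on A (\<lambda>x. f x + h x)"
  using assms unfolding continuous_on_def by (auto intro: tendsto_add)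

lemma open_affine_preimage_lcs:
  fixes U :: "'a::locally_convex_space set"
  assumes "open U"
  shows "open {x. a + t *\<^sub>R x \<in> U}"
proof -
  have "continuous_on UNIV (\<lambda>x::'a. a + t *\<^sub>R x)"
    by (intro continuous_on_add_lcs continuous_on_scaleR_lcs continuous_on_const continuous_on_id)
  from open_vimage[OF assms this] show ?thesis
    by (simp add: vimage_def)
qed

text \<open>For an open cone \<open>U\<close>, dividing by \<open>t\<close> shows that a large multiple of \<open>p\<close> carries any \<open>x\<close>
  into \<open>U\<close>.\<close>

lemma open_absorbing_lcs:
  fixes U :: "'a::locally_convex_space set"
  assumes "open U" and "p \<in> U"
  shows "\<exists>t>0. p + t *\<^sub>R x \<in> U"
proof -
  have "continuous_on UNIV (\<lambda>t::real. p + t *\<^sub>R x)"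
    by (intro continuous_on_add_lcs continuous_on_scaleR_lcs continuous_on_const continuous_on_id)
  from open_vimage[OF assms(1) this] have "open {t. p + t *\<^sub>R x \<in> U}"
    by (simp add: vimage_def)
  moreover have "0 \<in> {t. p + t *\<^sub>R x \<in> U}"
    using assms(2) by simp
  ultimately obtain e where "e > 0" and e: "ball 0 e \<subseteq> {t. p + t *\<^sub>R x \<in> U}"
    by (meson open_contains_ball)
  then have "e / 2 \<in> {t. p + t *\<^sub>R x \<in> U}"
    by (intro subsetD[OF e]) (auto simp: dist_real_def)
  with \<open>e > 0\<close> show ?thesis
    by (intro exI[of _ "e / 2"]) auto
qed

section \<open>Separation of a point from a convex cone\<close>

text \<open>Zorn's lemma. Maximality is recorded in the only form in which it is used: adding a ray
  through an outside point \<open>x\<close> makes the cone run into \<open>P\<close>.\<close>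

lemma maximal_cone_avoiding:
  fixes K P :: "'a::real_vector set"
  assumes "convex_cone K" and "K \<inter> P = {}"
  obtains M where "convex_cone M" "K \<subseteq> M" "M \<inter> P = {}"
    "\<And>x. x \<notin> M \<Longrightarrow> \<exists>m\<in>M. \<exists>t>0. m + t *\<^sub>R x \<in> P"
proof -
  define \<A> where "\<A> = {M. convex_cone M \<and> K \<subseteq> M \<and> M \<inter> P = {}}"
  have "\<exists>M\<in>\<A>. \<forall>X\<in>\<A>. M \<subseteq> X \<longrightarrow> X = M"
  proof (rule subset_Zorn_nonempty)
    show "\<A> \<noteq> {}"
      using assms by (auto simp: \<A>_def)
    fix \<C> assume "\<C> \<noteq> {}" and ch: "subset.chain \<A> \<C>"
    then have mem: "convex_cone X" "K \<subseteq> X" "X \<inter> P = {}" if "X \<in> \<C>" for X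
      using that by (auto simp: subset.chain_def \<A>_def)
    have "convex_cone (\<Union>\<C>)"
      unfolding convex_cone_iff
    proof (intro conjI ballI allI impI)
      show "0 \<in> \<Union>\<C>"
        using \<open>\<C> \<noteq> {}\<close> mem(1) convex_cone_contains_0 by blast
      fix x assume "x \<in> \<Union>\<C>"
      then obtain X where X: "X \<in> \<C>" "x \<in> X" by blast
      show "c *\<^sub>R x \<in> \<Union>\<C>" if "c \<ge> 0" for c
        using X mem(1) convex_cone_scaleR that by blast
      fix y assume "y \<in> \<Union>\<C>"
      then obtain Y where Y: "Y \<in> \<C>" "y \<in> Y" by blast
      have "X \<subseteq> Y \<or> Y \<subseteq> X"
        using ch X Y by (meson subset.chain_def subset_chain_def)
      then show "x + y \<in> \<Union>\<C>"
        using X Y mem(1) convex_cone_add by blast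
    qed
    moreover have "K \<subseteq> \<Union>\<C>" "\<Union>\<C> \<inter> P = {}"
      using mem \<open>\<C> \<noteq> {}\<close> by blast+
    ultimately show "\<Union>\<C> \<in> \<A>"
      by (simp add: \<A>_def)
  qed
  then obtain M where "M \<in> \<A>" and max: "\<And>X. X \<in> \<A> \<Longrightarrow> M \<subseteq> X \<Longrightarrow> X = M"
    by blast
  then have M: "convex_cone M" "K \<subseteq> M" "M \<inter> P = {}"
    by (auto simp: \<A>_def)
  have "\<exists>m\<in>M. \<exists>t>0. m + t *\<^sub>R x \<in> P" if "x \<notin> M" for x
  proof (rule ccontr)
    assume neg: "\<not> ?thesis"
    define N where "N = {m + t *\<^sub>R x | m t. m \<in> M \<and> t \<ge> 0}"
    have "convex_cone N"
      unfolding convex_cone_iff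
    proof (intro conjI ballI allI impI)
      show "0 \<in> N"
        using convex_cone_contains_0[OF M(1)] by (force simp: N_def)
      fix a assume "a \<in> N"
      then obtain m t where a: "a = m + t *\<^sub>R x" "m \<in> M" "t \<ge> 0"
        by (auto simp: N_def)
      show "c *\<^sub>R a \<in> N" if "c \<ge> 0" for c
        using a that convex_cone_scaleR[OF M(1) that a(2)]
        unfolding N_def by (intro CollectI exI[of _ "c *\<^sub>R m"] exI[of _ "c * t"])
          (auto simp: algebra_simps)
      fix b assume "b \<in> N"
      then obtain n s where b: "b = n + s *\<^sub>R x" "n \<in> M" "s \<ge> 0"
        by (auto simp: N_def)
      show "a + b \<in> N"
        using a b convex_cone_add[OF M(1) a(2) b(2)]
        unfolding N_def by (intro CollectI exI[of _ "m + n"] exI[of _ "t + s"])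
          (auto simp: algebra_simps)
    qed
    moreover have "M \<subseteq> N"
      unfolding N_def by force
    moreover have "N \<inter> P = {}"
    proof -
      have "m + t *\<^sub>R x \<notin> P" if "m \<in> M" "t \<ge> 0" for m t
        using neg that M(3) by (cases "t = 0") auto
      then show ?thesis by (auto simp: N_def)
    qed
    ultimately have "N = M"
      using M by (intro max) (auto simp: \<A>_def)
    moreover have "x \<in> N"
      using convex_cone_contains_0[OF M(1)] unfolding N_def
      by (intro CollectI exI[of _ 0] exI[of _ 1]) auto
    ultimately show False using that by blast
  qed
  with M show thesis by (rule that)
qed

text \<open>If \<open>M\<close> and \<open>- M\<close> cover the space, the line through any \<open>x\<close> in a direction \<open>p\<close> outside the
  closed cone \<open>M\<close> leaves \<open>M\<close> at exactly one point \<open>x + t p\<close>; that the line does meet both \<open>M\<close> and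
  its complement is the last hypothesis, applied to \<open>- x\<close> and to \<open>x\<close>. The exit parameter \<open>t\<close> is
  the value of the functional at \<open>x\<close>, and \<open>M\<close> is its nonnegative half-space.\<close>

lemma functional_of_half_space_cone:
  fixes M :: "'a::locally_convex_space set"
  assumes M: "convex_cone M" and "closed M" and cover: "\<And>x. x \<in> M \<or> - x \<in> M"
    and p: "p \<notin> M" and absorb: "\<And>x. \<exists>t>0. p + t *\<^sub>R x \<notin> M"
  obtains \<psi> where "\<psi> \<in> topological_dual" "\<And>x. x \<in> M \<longleftrightarrow> 0 \<le> \<psi> x" "\<psi> p < 0"
proof -
  note add = convex_cone_add[OF M] and scale = convex_cone_scaleR[OF M]
  have np: "- p \<in> M"
    using cover p by blast
  define L where "L = {x. x \<in> M \<and> - x \<in> M}"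
  have L: "subspace L"
  proof (rule subspaceI)
    show "0 \<in> L" using convex_cone_contains_0[OF M] by (simp add: L_def)
    fix x y assume "x \<in> L" "y \<in> L"
    then show "x + y \<in> L"
      using add[of x y] add[of "- x" "- y"] by (simp add: L_def)
  next
    fix c x assume x: "x \<in> L"
    show "c *\<^sub>R x \<in> L"
    proof (cases "c \<ge> 0")
      case True
      then show ?thesis using x scale[of c x] scale[of c "- x"] by (simp add: L_def)
    next
      case False
      then show ?thesis using x scale[of "- c" x] scale[of "- c" "- x"] by (simp add: L_def)
    qed
  qed
  have ex: "\<exists>t. x + t *\<^sub>R p \<in> L" for x
  proof -
    define T where "T = {t. x + t *\<^sub>R p \<in> M}"
    have cont: "continuous_on UNIV (\<lambda>t::real. x + t *\<^sub>R p)"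
      by (intro continuous_on_add_lcs continuous_on_scaleR_lcs continuous_on_const continuous_on_id)
    have "closed T"
      using continuous_closed_vimage[OF \<open>closed M\<close>, of "\<lambda>t::real. x + t *\<^sub>R p"] cont
      by (simp add: T_def vimage_def continuous_on_eq_continuous_at)
    have down: "s \<in> T" if "t \<in> T" "s \<le> t" for s t
    proof -
      have "(x + t *\<^sub>R p) + (t - s) *\<^sub>R (- p) \<in> M"
        by (rule add[OF _ scale]) (use that np in \<open>auto simp: T_def\<close>)
      then show ?thesis by (simp add: T_def algebra_simps)
    qed
    obtain t where t: "t > 0" "p + t *\<^sub>R x \<notin> M" using absorb by blast
    have "1 / t \<notin> T"
    proof
      assume "1 / t \<in> T"
      then have "t *\<^sub>R (x + (1 / t) *\<^sub>R p) \<in> M"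
        using t by (intro scale) (auto simp: T_def)
      with t show False by (simp add: algebra_simps)
    qed
    then have bdd: "bdd_above T"
      using down by (intro bdd_aboveI[of _ "1 / t"]) (meson linear)
    obtain s where s: "s > 0" "p + s *\<^sub>R (- x) \<notin> M" using absorb by blast
    then have "- (p + s *\<^sub>R (- x)) \<in> M" using cover by blast
    then have "(1 / s) *\<^sub>R (- (p + s *\<^sub>R (- x))) \<in> M"
      using s by (intro scale) auto
    moreover have "(1 / s) *\<^sub>R (- (p + s *\<^sub>R (- x))) = x + (- (1 / s)) *\<^sub>R p"
      using s by (simp add: algebra_simps)
    ultimately have "- (1 / s) \<in> T" by (simp add: T_def)
    then have "T \<noteq> {}" by blast
    define \<tau> where "\<tau> = Sup T"
    have "\<tau> \<in> T"
      unfolding \<tau>_def using \<open>T \<noteq> {}\<close> bdd \<open>closed T\<close> by (rule closed_contains_Sup)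
    \<comment> \<open>Past the exit parameter the line runs in \<open>- M\<close>, and a limit point of it stays there.\<close>
    have cont': "continuous_on UNIV (\<lambda>t::real. (- x) + (- t) *\<^sub>R p)"
      by (intro continuous_on_add_lcs continuous_on_scaleR_lcs continuous_on_const continuous_on_id
          continuous_on_minus)
    have "closed {t. - x + (- t) *\<^sub>R p \<in> M}"
      using continuous_closed_vimage[OF \<open>closed M\<close>, of "\<lambda>t::real. - x + (- t) *\<^sub>R p"] cont'
      by (simp add: vimage_def continuous_on_eq_continuous_at)
    moreover have "{\<tau><..} \<subseteq> {t. - x + (- t) *\<^sub>R p \<in> M}"
    proof
      fix t assume "t \<in> {\<tau><..}"
      then have "t \<notin> T" using cSup_upper[OF _ bdd] by (force simp: \<tau>_def)
      then have "- (x + t *\<^sub>R p) \<in> M" using cover[of "x + t *\<^sub>R p"] by (simp add: T_def)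
      then show "t \<in> {t. - x + (- t) *\<^sub>R p \<in> M}" by (simp add: algebra_simps)
    qed
    ultimately have "closure {\<tau><..} \<subseteq> {t. - x + (- t) *\<^sub>R p \<in> M}"
      by (intro closure_minimal)
    then have "- x + (- \<tau>) *\<^sub>R p \<in> M" by auto
    with \<open>\<tau> \<in> T\<close> have "x + \<tau> *\<^sub>R p \<in> L"
      by (simp add: L_def T_def algebra_simps)
    then show ?thesis ..
  qed
  have pL: "p \<notin> L" using p by (simp add: L_def)
  have unique: "s = t" if "x + s *\<^sub>R p \<in> L" "x + t *\<^sub>R p \<in> L" for x s t
  proof (rule ccontr)
    assume "s \<noteq> t"
    have "(x + s *\<^sub>R p) - (x + t *\<^sub>R p) \<in> L" by (rule subspace_diff[OF L that])
    then have "(s - t) *\<^sub>R p \<in> L" by (simp add: scaleR_left_diff_distrib)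
    then have "(1 / (s - t)) *\<^sub>R ((s - t) *\<^sub>R p) \<in> L" by (rule subspace_scale[OF L])
    with \<open>s \<noteq> t\<close> pL show False by simp
  qed
  define \<psi> where "\<psi> x = (THE t. x + t *\<^sub>R p \<in> L)" for x
  have \<psi>L: "x + \<psi> x *\<^sub>R p \<in> L" for x
    unfolding \<psi>_def by (rule theI') (use ex unique in blast)
  have \<psi>_eq: "\<psi> x = t" if "x + t *\<^sub>R p \<in> L" for x t
    using unique[OF \<psi>L that] .
  have "linear \<psi>"
  proof (rule linearI)
    fix x y
    show "\<psi> (x + y) = \<psi> x + \<psi> y"
      using subspace_add[OF L \<psi>L[of x] \<psi>L[of y]] by (intro \<psi>_eq) (simp add: algebra_simps)
    fix c
    show "\<psi> (c *\<^sub>R x) = c *\<^sub>R \<psi> x"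
      using subspace_scale[OF L \<psi>L[of x], of c] by (intro \<psi>_eq) (simp add: algebra_simps)
  qed
  have \<psi>p: "\<psi> p = - 1"
    using subspace_0[OF L] by (intro \<psi>_eq) simp
  have iff: "x \<in> M \<longleftrightarrow> 0 \<le> \<psi> x" for x
  proof
    assume "x \<in> M"
    show "0 \<le> \<psi> x"
    proof (rule ccontr)
      assume neg: "\<not> 0 \<le> \<psi> x"
      have "x + (- (x + \<psi> x *\<^sub>R p)) \<in> M"
        using \<open>x \<in> M\<close> \<psi>L[of x] by (intro add) (auto simp: L_def)
      then have "(- \<psi> x) *\<^sub>R p \<in> M" by simp
      then have "(1 / (- \<psi> x)) *\<^sub>R ((- \<psi> x) *\<^sub>R p) \<in> M"
        by (rule scale[rotated]) (use neg in auto)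
      with neg p show False by simp
    qed
  next
    assume "0 \<le> \<psi> x"
    have "(x + \<psi> x *\<^sub>R p) + \<psi> x *\<^sub>R (- p) \<in> M"
      by (rule add[OF _ scale]) (use \<open>0 \<le> \<psi> x\<close> \<psi>L[of x] np in \<open>auto simp: L_def\<close>)
    then show "x \<in> M" by simp
  qed
  have "continuous_on UNIV \<psi>"
  proof -
    have "\<psi> x < a \<longleftrightarrow> a *\<^sub>R p + 1 *\<^sub>R x \<in> - M" for a x
      using \<psi>p by (simp add: iff linear_add[OF \<open>linear \<psi>\<close>] linear_scale[OF \<open>linear \<psi>\<close>]) linarith
    then have lt: "open {x. \<psi> x < a}" for a
      using open_affine_preimage_lcs[of "- M" "a *\<^sub>R p" 1] \<open>closed M\<close> by (simp add: open_Compl)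
    have "a < \<psi> x \<longleftrightarrow> (- a) *\<^sub>R p + (- 1) *\<^sub>R x \<in> - M" for a x
      using \<psi>p by (simp add: iff linear_diff[OF \<open>linear \<psi>\<close>] linear_neg[OF \<open>linear \<psi>\<close>]
          linear_scale[OF \<open>linear \<psi>\<close>]) linarith
    then have gt: "open {x. a < \<psi> x}" for a
      using open_affine_preimage_lcs[of "- M" "(- a) *\<^sub>R p" "- 1"] \<open>closed M\<close>
      by (simp add: open_Compl)
    show ?thesis
      unfolding continuous_on_def
    proof (intro ballI order_tendstoI)
      fix x a
      show "\<forall>\<^sub>F y in at x. a < \<psi> y" if "a < \<psi> x"
        unfolding eventually_at_topological using gt[of a] that by blast
      show "\<forall>\<^sub>F y in at x. \<psi> y < a" if "\<psi> x < a"
        unfolding eventually_at_topological using lt[of a] that by blast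
    qed
  qed
  then have "\<psi> \<in> topological_dual"
    using \<open>linear \<psi>\<close> by (simp add: topological_dual_def)
  then show thesis
    by (rule that) (use iff \<psi>p in auto)
qed


text \<open>Maximality of \<open>M\<close> yields everything the half-space lemma asks for. That \<open>x \<notin> M\<close> is witnessed by
  some \<open>m + t x\<close> in the open set \<open>P\<close>, a condition stable under perturbing \<open>x\<close>, so \<open>M\<close> is closed;
  witnesses for \<open>x\<close> and \<open>- x\<close> at the same time would combine to a point of \<open>M \<inter> P\<close>.\<close>

lemma separating_functional_of_cone:
  fixes K :: "'a::locally_convex_space set"
  assumes K: "convex_cone K" and "p \<notin> closure K"
  obtains \<psi> where "\<psi> \<in> topological_dual" "\<And>x. x \<in> K \<Longrightarrow> 0 \<le> \<psi> x" "\<psi> p < 0"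
proof -
  have "open {x. p + 1 *\<^sub>R x \<in> - closure K}" "0 \<in> {x. p + 1 *\<^sub>R x \<in> - closure K}"
    using assms(2) open_affine_preimage_lcs[of "- closure K" p 1] by auto
  then obtain V where V: "open V" "0 \<in> V" "convex V" "V \<subseteq> {x. p + 1 *\<^sub>R x \<in> - closure K}"
    using convex_neighbourhood_base by blast
  \<comment> \<open>The open convex cone generated by the neighbourhood \<open>p + V\<close>, without the origin; each set of
    the union is a positive multiple of \<open>p + V\<close>, written as a preimage to make openness immediate.\<close>
  define P where "P = (\<Union>t\<in>{0<..}. {x. - p + t *\<^sub>R x \<in> V})"
  have mem_P: "x \<in> P \<longleftrightarrow> (\<exists>t>0. t *\<^sub>R x - p \<in> V)" for x
    by (auto simp: P_def)
  have "open P"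
    unfolding P_def using V(1) by (intro open_UN ballI open_affine_preimage_lcs)
  have "p \<in> P"
    using V(2) by (auto simp: mem_P intro!: exI[of _ 1])
  have P_scale: "c *\<^sub>R x \<in> P" if "c > 0" "x \<in> P" for c x
  proof -
    obtain t where "t > 0" "t *\<^sub>R x - p \<in> V" using \<open>x \<in> P\<close> unfolding mem_P by blast
    with \<open>c > 0\<close> show ?thesis unfolding mem_P by (intro exI[of _ "t / c"]) simp
  qed
  have P_add: "x + y \<in> P" if "x \<in> P" "y \<in> P" for x y
  proof -
    obtain t s where ts: "t > 0" "t *\<^sub>R x - p \<in> V" "s > 0" "s *\<^sub>R y - p \<in> V"
      using \<open>x \<in> P\<close> \<open>y \<in> P\<close> unfolding mem_P by blast
    \<comment> \<open>The weights make both \<open>x\<close> and \<open>y\<close> appear with the harmonic factor \<open>t s / (t + s)\<close>.\<close>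
    have "(s / (t + s)) *\<^sub>R (t *\<^sub>R x - p) + (t / (t + s)) *\<^sub>R (s *\<^sub>R y - p) \<in> V"
      using ts by (intro convexD[OF V(3)]) (auto simp: add_divide_distrib[symmetric] add.commute)
    also have "(s / (t + s)) *\<^sub>R (t *\<^sub>R x - p) + (t / (t + s)) *\<^sub>R (s *\<^sub>R y - p)
        = (t * s / (t + s)) *\<^sub>R (x + y) - (s / (t + s) + t / (t + s)) *\<^sub>R p"
      by (simp add: algebra_simps)
    also have "s / (t + s) + t / (t + s) = 1"
      using ts by (simp add: add_divide_distrib[symmetric] add.commute)
    finally show ?thesis
      using ts unfolding mem_P by (intro exI[of _ "t * s / (t + s)"]) simp
  qed
  have "K \<inter> P = {}"
  proof (rule ccontr)
    assume "K \<inter> P \<noteq> {}"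
    then obtain x t where x: "x \<in> K" "t > 0" "t *\<^sub>R x - p \<in> V" by (auto simp: mem_P)
    then have "t *\<^sub>R x \<in> K" by (intro convex_cone_scaleR[OF K]) auto
    moreover have "t *\<^sub>R x \<notin> closure K" using V(4) x(3) by auto
    ultimately show False using closure_subset by blast
  qed
  then obtain M where M: "convex_cone M" "K \<subseteq> M" "M \<inter> P = {}"
    and max: "\<And>x. x \<notin> M \<Longrightarrow> \<exists>m\<in>M. \<exists>t>0. m + t *\<^sub>R x \<in> P"
    using maximal_cone_avoiding[OF K] by metis
  have "open (- M)"
  proof (subst open_subopen, intro ballI)
    fix x assume "x \<in> - M"
    then obtain m t where m: "m \<in> M" "t > 0" "m + t *\<^sub>R x \<in> P" using max by blast
    have "{y. m + t *\<^sub>R y \<in> P} \<subseteq> - M"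
    proof (intro subsetI ComplI)
      fix y assume y: "y \<in> {y. m + t *\<^sub>R y \<in> P}" "y \<in> M"
      have "m + t *\<^sub>R y \<in> M"
        by (rule convex_cone_add[OF M(1) m(1) convex_cone_scaleR[OF M(1)]]) (use m y in auto)
      with y M(3) show False by blast
    qed
    then show "\<exists>T. open T \<and> x \<in> T \<and> T \<subseteq> - M"
      using open_affine_preimage_lcs[OF \<open>open P\<close>, of m t] m(3) by blast
  qed
  moreover have "x \<in> M \<or> - x \<in> M" for x
  proof (rule ccontr)
    assume "\<not> (x \<in> M \<or> - x \<in> M)"
    then obtain m t n s where mt: "m \<in> M" "t > 0" "m + t *\<^sub>R x \<in> P"
      and ns: "n \<in> M" "s > 0" "n + s *\<^sub>R (- x) \<in> P"
      using max by metis
    \<comment> \<open>Eliminating \<open>x\<close> between the two points of \<open>P\<close> leaves a point of \<open>M\<close>.\<close>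
    have "s *\<^sub>R (m + t *\<^sub>R x) + t *\<^sub>R (n + s *\<^sub>R (- x)) \<in> P"
      by (rule P_add[OF P_scale P_scale]) (use mt ns in auto)
    then have "s *\<^sub>R m + t *\<^sub>R n \<in> P" by (simp add: algebra_simps)
    moreover have "s *\<^sub>R m + t *\<^sub>R n \<in> M"
      using mt ns by (intro convex_cone_add[OF M(1)] convex_cone_scaleR[OF M(1)]) auto
    ultimately show False using M(3) by blast
  qed
  moreover have "p \<notin> M" using M(3) \<open>p \<in> P\<close> by blast
  moreover have "\<exists>t>0. p + t *\<^sub>R x \<notin> M" for x
    using open_absorbing_lcs[OF \<open>open P\<close> \<open>p \<in> P\<close>] M(3) by blast
  ultimately obtain \<psi> where "\<psi> \<in> topological_dual" "\<And>x. x \<in> M \<longleftrightarrow> 0 \<le> \<psi> x" "\<psi> p < 0"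
    using functional_of_half_space_cone[OF M(1)] by (metis closed_def)
  with M(2) show thesis by (intro that) auto
qed

section \<open>Functionals and quasi-relative interiors\<close>

lemma dual_nonneg_on_closure:
  assumes "\<psi> \<in> topological_dual" and "\<And>x. x \<in> K \<Longrightarrow> 0 \<le> \<psi> x" and "x \<in> closure K"
  shows "0 \<le> \<psi> x"
proof -
  have "closed {x. 0 \<le> \<psi> x}"
    using assms(1) by (intro closed_Collect_le) (auto simp: topological_dual_def)
  then have "closure K \<subseteq> {x. 0 \<le> \<psi> x}"
    using assms(2) by (intro closure_minimal) auto
  with assms(3) show ?thesis by blast
qed

text \<open>A linear functional of constant sign on a subspace is zero on it.\<close>

lemma dual_eq_0_of_subspace_closure:
  assumes "\<psi> \<in> topological_dual" and nonneg: "\<And>x. x \<in> U \<Longrightarrow> 0 \<le> \<psi> x"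
    and "subspace (closure (conic hull U))" and "x \<in> U"
  shows "\<psi> x = 0"
proof -
  have lin: "linear \<psi>" using assms(1) by (simp add: topological_dual_def)
  have "0 \<le> \<psi> y" if "y \<in> conic hull U" for y
    using that nonneg by (auto simp: conic_hull_explicit linear_scale[OF lin])
  then have cl: "0 \<le> \<psi> y" if "y \<in> closure (conic hull U)" for y
    using dual_nonneg_on_closure[OF assms(1) _ that] by blast
  have "x \<in> closure (conic hull U)"
    using \<open>x \<in> U\<close> by (meson closure_subset hull_inc subsetD)
  moreover from this have "- x \<in> closure (conic hull U)"
    by (rule subspace_neg[OF assms(3)])
  ultimately show ?thesis
    using cl[of x] cl[of "- x"] by (simp add: linear_neg[OF lin])
qed

text \<open>A closed convex cone is the intersection of the half-spaces containing it. If the boundary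
  hyperplanes of all these half-spaces contained the cone, it would be the intersection
  of the hyperplanes.\<close>

lemma nonneg_functional_of_not_subspace_closure:
  fixes K :: "'a::locally_convex_space set"
  assumes K: "convex_cone K" and "\<not> subspace (closure K)"
  obtains \<psi> x where "\<psi> \<in> topological_dual" "\<And>y. y \<in> K \<Longrightarrow> 0 \<le> \<psi> y" "x \<in> K" "0 < \<psi> x"
proof -
  define N where "N = {\<psi> \<in> topological_dual. \<forall>y\<in>K. 0 \<le> \<psi> y}"
  have "\<exists>\<psi>\<in>N. \<exists>x\<in>K. 0 < \<psi> x"
  proof (rule ccontr)
    assume neg: "\<not> ?thesis"
    have lin: "linear \<psi>" if "\<psi> \<in> N" for \<psi>
      using that by (simp add: N_def topological_dual_def)
    have vanish: "\<psi> x = 0" if "\<psi> \<in> N" "x \<in> closure K" for \<psi> x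
    proof -
      have "\<psi> y = 0" if "y \<in> K" for y
        using neg \<open>\<psi> \<in> N\<close> that by (force simp: N_def)
      moreover have "closed {x. \<psi> x = 0}"
        using \<open>\<psi> \<in> N\<close> by (intro closed_Collect_eq) (auto simp: N_def topological_dual_def)
      ultimately have "closure K \<subseteq> {x. \<psi> x = 0}"
        by (intro closure_minimal) auto
      with that show ?thesis by blast
    qed
    have "closure K = {x. \<forall>\<psi>\<in>N. \<psi> x = 0}"
    proof (intro equalityI subsetI)
      fix x assume x: "x \<in> {x. \<forall>\<psi>\<in>N. \<psi> x = 0}"
      show "x \<in> closure K"
      proof (rule ccontr)
        assume "x \<notin> closure K"
        then obtain \<psi> where "\<psi> \<in> N" "\<psi> x < 0"
          by (rule separating_functional_of_cone[OF K]) (auto simp: N_def)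
        with x show False by auto
      qed
    qed (use vanish in blast)
    moreover have "subspace {x. \<forall>\<psi>\<in>N. \<psi> x = 0}"
      using lin by (intro subspaceI) (auto simp: linear_0 linear_add linear_scale)
    ultimately show False using assms(2) by simp
  qed
  then show thesis using that by (auto simp: N_def)
qed

section \<open>The Lagrange dual\<close>

lemma edom_ereal:
  assumes "eproper f" and "x \<in> edom f"
  shows "f x = ereal (real_of_ereal (f x))"
  using assms by (cases "f x") (auto simp: eproper_def edom_def dest: spec[of _ x])

text \<open>Along a segment, both convexity inequalities leave slack that the summand
  \<open>\<real>\<^sub>+ \<times> C\<close> absorbs.\<close>

lemma convexlike_of_convex:
  assumes C: "convex_cone C" and f: "eproper f"
    and "convex S" and "econvex f" and "cone_convex C g"
  shows "convexlike f g S C"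
  unfolding convexlike_def
proof (rule convexI)
  let ?A = "{(real_of_ereal (f x), y) |x y. x \<in> edom f \<inter> S \<and> g x = Elem y} + {0..} \<times> C"
  fix p q and u v :: real
  assume "p \<in> ?A" "q \<in> ?A" and uv: "0 \<le> u" "0 \<le> v" "u + v = 1"
  obtain x1 y1 a1 z1 where p: "p = (real_of_ereal (f x1) + a1, y1 + z1)"
    "x1 \<in> edom f" "x1 \<in> S" "g x1 = Elem y1" "a1 \<ge> 0" "z1 \<in> C"
    using \<open>p \<in> ?A\<close> by (auto elim!: set_plus_elim)
  obtain x2 y2 a2 z2 where q: "q = (real_of_ereal (f x2) + a2, y2 + z2)"
    "x2 \<in> edom f" "x2 \<in> S" "g x2 = Elem y2" "a2 \<ge> 0" "z2 \<in> C"
    using \<open>q \<in> ?A\<close> by (auto elim!: set_plus_elim)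
  have v: "v = 1 - u" using uv by simp
  define x where "x = u *\<^sub>R x1 + v *\<^sub>R x2"
  have "x \<in> S"
    unfolding x_def using \<open>convex S\<close> p q uv by (intro convexD) auto
  have "f x \<le> ereal u * f x1 + ereal v * f x2"
    using \<open>econvex f\<close> uv unfolding econvex_def x_def v by auto
  also have "\<dots> = ereal (u * real_of_ereal (f x1) + v * real_of_ereal (f x2))"
    by (subst edom_ereal[OF f p(2)], subst edom_ereal[OF f q(2)]) simp
  finally have fx: "f x \<le> ereal (u * real_of_ereal (f x1) + v * real_of_ereal (f x2))" .
  then have "x \<in> edom f"
    by (auto simp: edom_def less_le_trans intro: le_less_trans)
  have fx': "real_of_ereal (f x) \<le> u * real_of_ereal (f x1) + v * real_of_ereal (f x2)"
    using fx by (subst (asm) edom_ereal[OF f \<open>x \<in> edom f\<close>]) simp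
  have "cone_le C (g x) (u *\<^sub>R g x1 + v *\<^sub>R g x2)"
    using \<open>cone_convex C g\<close> uv unfolding cone_convex_def x_def v by auto
  then obtain y where y: "g x = Elem y" "u *\<^sub>R y1 + v *\<^sub>R y2 - y \<in> C"
    using p(4) q(4) by (cases "g x") auto
  have "(u *\<^sub>R y1 + v *\<^sub>R y2 - y) + (u *\<^sub>R z1 + v *\<^sub>R z2) \<in> C"
    using y p q uv by (intro convex_cone_add[OF C] convex_cone_scaleR[OF C])
  moreover have "0 \<le> u * (real_of_ereal (f x1) + a1) + v * (real_of_ereal (f x2) + a2)
      - real_of_ereal (f x)"
    using fx' mult_nonneg_nonneg[OF uv(1) p(5)] mult_nonneg_nonneg[OF uv(2) q(5)]
    unfolding distrib_left by linarith
  moreover have "u *\<^sub>R p + v *\<^sub>R q = (real_of_ereal (f x), y) +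
      (u * (real_of_ereal (f x1) + a1) + v * (real_of_ereal (f x2) + a2) - real_of_ereal (f x),
       (u *\<^sub>R y1 + v *\<^sub>R y2 - y) + (u *\<^sub>R z1 + v *\<^sub>R z2))"
    by (simp add: p(1) q(1) algebra_simps)
  ultimately show "u *\<^sub>R p + v *\<^sub>R q \<in> ?A"
    using \<open>x \<in> S\<close> \<open>x \<in> edom f\<close> y(1) by (simp only:) (rule set_plus_intro, auto)
qed

lemma weak_duality:
  assumes "\<phi> \<in> dual_cone C"
  shows "dual_objective f g S \<phi> \<le> primal_value f g S C"
  unfolding primal_value_def
proof (rule INF_greatest)
  fix x assume x: "x \<in> {x \<in> S. g x \<in> Elem ` uminus ` C}"
  then obtain z where z: "z \<in> C" "g x = Elem (- z)" by auto
  have "\<phi> (- z) \<le> 0"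
    using assms z by (auto simp: dual_cone_def topological_dual_def linear_neg)
  then have "f x + pairing \<phi> (g x) \<le> f x + 0"
    using z by (intro add_left_mono) (simp add: zero_ereal_def)
  moreover have "dual_objective f g S \<phi> \<le> f x + pairing \<phi> (g x)"
    unfolding dual_objective_def using x by (intro INF_lower) auto
  ultimately show "dual_objective f g S \<phi> \<le> f x" by simp
qed

lemma strong_duality_of_multiplier:
  assumes "\<phi> \<in> dual_cone C" and "primal_value f g S C \<le> dual_objective f g S \<phi>"
  shows "primal_value f g S C = dual_value f g S C \<and> (\<exists>\<phi>. dual_solution f g S C \<phi>)"
proof -
  have "dual_value f g S C \<le> primal_value f g S C"
    unfolding dual_value_def by (intro SUP_least weak_duality)
  moreover have "dual_objective f g S \<phi> \<le> dual_value f g S C"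
    unfolding dual_value_def using assms(1) by (rule SUP_upper)
  ultimately show ?thesis
    using assms by (auto simp: dual_solution_def intro!: exI[of _ \<phi>])
qed

text \<open>The conic extension recedes in the directions \<open>C \<times> {0}\<close> and \<open>{0} \<times> \<real>\<^sub>+\<close>, so the components of
  a functional that is nonnegative on it are nonnegative on \<open>C\<close> and on \<open>\<real>\<^sub>+\<close>. Positivity
  somewhere on the extension is inherited from the generated cone: a functional that is
  nonpositive on a set is nonpositive on the convex cone generated by it.\<close>

lemma functional_of_qri_separation:
  fixes g :: "'x \<Rightarrow> 'z::locally_convex_space bullet"
  assumes C: "convex_cone C" and fin: "\<bar>primal_value f g S C\<bar> \<noteq> \<infinity>"
    and sep: "qri_separation f g S C"
  obtains \<phi> r where "\<phi> \<in> dual_cone C" "0 \<le> r"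
    "\<And>x y. x \<in> edom f \<inter> S \<Longrightarrow> g x = Elem y \<Longrightarrow>
      0 \<le> \<phi> y + r * (real_of_ereal (f x) - real_of_ereal (primal_value f g S C))"
    "r = 0 \<Longrightarrow> \<exists>y\<in>image_plus_cone f g S C. 0 < \<phi> y"
proof -
  define v where "v = real_of_ereal (primal_value f g S C)"
  define E where "E = conic_extension f g S C"
  define K where "K = conic hull (convex hull (E \<union> {(0, 0)}))"
  have E_I: "(y + z, real_of_ereal (f x) - v + \<epsilon>) \<in> E"
    if "x \<in> edom f" "x \<in> S" "g x = Elem y" "z \<in> C" "0 \<le> \<epsilon>" for x y z \<epsilon>
    using that unfolding E_def conic_extension_def v_def by blast
  have K_hull: "K = convex_cone hull (E \<union> {(0, 0)})"
    unfolding K_def by (simp add: convex_cone_hull_separate_nonempty)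
  have "(0, 0) \<in> convex hull (E \<union> {(0, 0)})"
    by (rule hull_inc) simp
  moreover have "(\<lambda>v. v - (0, 0)) ` U = U" for U :: "('z \<times> real) set"
    unfolding zero_prod_def[symmetric] by simp
  ultimately have "\<not> subspace (closure K)"
    using sep by (simp add: qri_separation_def quasi_relative_interior_def K_def E_def)
  moreover have "convex_cone K"
    unfolding K_hull by (rule convex_cone_convex_cone_hull)
  ultimately obtain \<psi> w where \<psi>: "\<psi> \<in> topological_dual" "\<And>y. y \<in> K \<Longrightarrow> 0 \<le> \<psi> y"
    and w: "w \<in> K" "0 < \<psi> w"
    using nonneg_functional_of_not_subspace_closure by blast
  have lin: "linear \<psi>" and cont: "continuous_on UNIV \<psi>"
    using \<psi>(1) by (auto simp: topological_dual_def)
  have \<psi>E: "0 \<le> \<psi> e" if "e \<in> E" for e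
    using that by (intro \<psi>(2)) (auto simp: K_hull intro: hull_inc)
  have "\<exists>e\<in>E. 0 < \<psi> e"
  proof (rule ccontr)
    assume neg: "\<not> ?thesis"
    have "convex_cone {x. \<psi> x \<le> 0}"
      by (auto simp: convex_cone_iff linear_0[OF lin] linear_add[OF lin] linear_scale[OF lin]
          mult_nonneg_nonpos intro: add_nonpos_nonpos)
    moreover have "E \<union> {(0, 0)} \<subseteq> {x. \<psi> x \<le> 0}"
      using neg linear_0[OF lin] by (auto simp: zero_prod_def not_less)
    ultimately have "K \<subseteq> {x. \<psi> x \<le> 0}"
      unfolding K_hull by (intro hull_minimal)
    with w show False by auto
  qed
  then obtain e where e: "e \<in> E" "0 < \<psi> e" by blast
  define \<phi> where "\<phi> y = \<psi> (y, 0)" for y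
  define r where "r = \<psi> (0, 1)"
  have split: "\<psi> (y, a) = \<phi> y + r * a" for y a
  proof -
    have "\<psi> (y, a) = \<psi> ((y, 0) + a *\<^sub>R (0, 1))" by simp
    also have "\<dots> = \<phi> y + r * a"
      by (simp only: linear_add[OF lin] linear_scale[OF lin]) (simp add: \<phi>_def r_def)
    finally show ?thesis .
  qed
  have "linear \<phi>"
  proof (rule linearI)
    fix x y
    show "\<phi> (x + y) = \<phi> x + \<phi> y"
      using linear_add[OF lin, of "(x, 0)" "(y, 0)"] by (simp add: \<phi>_def)
    fix c
    show "\<phi> (c *\<^sub>R x) = c *\<^sub>R \<phi> x"
      using linear_scale[OF lin, of c "(x, 0)"] by (simp add: \<phi>_def)
  qed
  moreover have "continuous_on UNIV \<phi>"
    unfolding \<phi>_def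
    by (rule continuous_on_compose2[OF cont]) (auto intro!: continuous_intros)
  ultimately have dual: "\<phi> \<in> topological_dual" by (simp add: topological_dual_def)
  obtain x0 z0 where x0: "x0 \<in> edom f" "x0 \<in> S" "z0 \<in> C" "g x0 = Elem (- z0)"
  proof -
    have "primal_value f g S C < \<infinity>" using fin by auto
    then show thesis
      using that unfolding primal_value_def INF_less_iff by (auto simp: edom_def)
  qed
  \<comment> \<open>A functional bounded below along a ray is nonnegative in the direction of the ray.\<close>
  have ray: "0 \<le> b" if bound: "\<And>t. 0 \<le> t \<Longrightarrow> 0 \<le> a + t * b" for a b :: real
  proof (rule ccontr)
    assume "\<not> 0 \<le> b"
    then have "a + ((\<bar>a\<bar> + 1) / - b) * b = a - (\<bar>a\<bar> + 1)" "0 \<le> (\<bar>a\<bar> + 1) / - b"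
      by (auto simp: field_simps)
    with bound[of "(\<bar>a\<bar> + 1) / - b"] show False by linarith
  qed
  have "0 \<le> r"
  proof (rule ray)
    fix t :: real assume "0 \<le> t"
    show "0 \<le> (\<phi> (- z0 + z0) + r * (real_of_ereal (f x0) - v)) + t * r"
      using \<psi>E[OF E_I[OF x0(1,2,4,3) \<open>0 \<le> t\<close>]] by (simp add: split algebra_simps)
  qed
  have "0 \<le> \<phi> z" if "z \<in> C" for z
  proof (rule ray)
    fix t :: real assume "0 \<le> t"
    then have "t *\<^sub>R z \<in> C" using that by (intro convex_cone_scaleR[OF C])
    from \<psi>E[OF E_I[OF x0(1,2,4) this order_refl]]
    show "0 \<le> (\<phi> (- z0) + r * (real_of_ereal (f x0) - v)) + t * \<phi> z"
      by (simp only: split linear_add[OF \<open>linear \<phi>\<close>] linear_scale[OF \<open>linear \<phi>\<close>]) simp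
  qed
  then have 1: "\<phi> \<in> dual_cone C" using dual by (simp add: dual_cone_def)
  have 2: "0 \<le> \<phi> y + r * (real_of_ereal (f x) - v)" if "x \<in> edom f \<inter> S" "g x = Elem y" for x y
    using \<psi>E[OF E_I[of x y 0 0]] that convex_cone_contains_0[OF C] by (simp add: split)
  have 3: "\<exists>y\<in>image_plus_cone f g S C. 0 < \<phi> y" if "r = 0"
  proof -
    obtain x y z \<epsilon> where "e = (y + z, real_of_ereal (f x) - v + \<epsilon>)"
      "x \<in> edom f \<inter> S" "g x = Elem y" "z \<in> C"
      using e(1) unfolding E_def conic_extension_def v_def by blast
    with e(2) that show ?thesis
      by (auto simp: split image_plus_cone_def intro!: bexI[of _ "y + z"] set_plus_intro)
  qed
  show thesis by (rule that[OF 1 \<open>0 \<le> r\<close> 2[unfolded v_def] 3])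
qed

text \<open>For a Slater-type point \<open>x'\<close> the subspace argument is applied to \<open>C + g x'\<close>: there \<open>\<phi>\<close> is
  nonnegative, hence zero, so \<open>\<phi>\<close> is constant on \<open>C\<close>, vanishes on \<open>C - C\<close> and, by density, everywhere.
  The other two conditions place the origin in the quasi-relative interior of the image, and
  the argument applies to the image itself.\<close>

lemma regularity_forces_functional_zero:
  assumes rc: "RC6' f g S C \<or> RC6 f g S C \<or> RC7 f g S C"
    and \<phi>: "\<phi> \<in> topological_dual" and nonneg: "\<And>y. y \<in> image_plus_cone f g S C \<Longrightarrow> 0 \<le> \<phi> y"
    and y: "y \<in> image_plus_cone f g S C"
  shows "\<phi> y = 0"
proof (cases "0 \<in> quasi_relative_interior (image_plus_cone f g S C)")
  case True
  then have "subspace (closure (conic hull (image_plus_cone f g S C)))"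
    by (simp add: quasi_relative_interior_def)
  then show ?thesis
    using dual_eq_0_of_subspace_closure[OF \<phi>, of "image_plus_cone f g S C" y] nonneg y by blast
next
  case False
  then have "RC6' f g S C"
    using rc by (auto simp: RC6_def RC7_def quasi_interior_def quasi_relative_interior_def)
  then obtain x' c where x': "x' \<in> edom f \<inter> S" "g x' = Elem (- c)"
      "c \<in> quasi_relative_interior C" and dense: "closure (minkowski_diff C C) = UNIV"
    by (auto simp: RC6'_def)
  have lin: "linear \<phi>" using \<phi> by (simp add: topological_dual_def)
  have "subspace (closure (conic hull ((\<lambda>z. z - c) ` C)))"
    using x'(3) by (simp add: quasi_relative_interior_def)
  moreover have "0 \<le> \<phi> d" if d: "d \<in> (\<lambda>z. z - c) ` C" for d
  proof (rule nonneg)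
    obtain z where "z \<in> C" "d = - c + z" using d by auto
    moreover have "- c \<in> {y. \<exists>x\<in>edom f \<inter> S. g x = Elem y}" using x' by blast
    ultimately show "d \<in> image_plus_cone f g S C"
      unfolding image_plus_cone_def by (simp only: set_plus_intro)
  qed
  ultimately have "\<phi> (z - c) = 0" if "z \<in> C" for z
    using dual_eq_0_of_subspace_closure[OF \<phi>, of "(\<lambda>z. z - c) ` C" "z - c"] that by blast
  then have "\<phi> z = \<phi> c" if "z \<in> C" for z
    using that by (simp add: linear_diff[OF lin])
  then have "\<phi> d = 0" if "d \<in> minkowski_diff C C" for d
    using that by (auto simp: minkowski_diff_def linear_diff[OF lin])
  moreover have "closed {d. \<phi> d = 0}"
    using \<phi> by (intro closed_Collect_eq) (auto simp: topological_dual_def)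
  ultimately have "closure (minkowski_diff C C) \<subseteq> {d. \<phi> d = 0}"
    by (intro closure_minimal) auto
  with dense show ?thesis by auto
qed

text \<open>Where \<open>f\<close> or \<open>g\<close> is infinite the Lagrangian is \<open>+\<infinity>\<close>, so nonnegativity of \<open>(\<phi>, r)\<close> at the
  points over the domain, divided by \<open>r\<close>, bounds it below by the primal value on all of \<open>S\<close>.\<close>

lemma multiplier_of_functional:
  assumes f: "eproper f" and fin: "\<bar>primal_value f g S C\<bar> \<noteq> \<infinity>" and "\<phi> \<in> dual_cone C" and "0 < r"
    and pos: "\<And>x y. x \<in> edom f \<inter> S \<Longrightarrow> g x = Elem y \<Longrightarrow>
      0 \<le> \<phi> y + r * (real_of_ereal (f x) - real_of_ereal (primal_value f g S C))"
  shows "(\<lambda>z. \<phi> z / r) \<in> dual_cone C"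
    and "primal_value f g S C \<le> dual_objective f g S (\<lambda>z. \<phi> z / r)"
proof -
  have lin: "linear \<phi>" and cont: "continuous_on UNIV \<phi>"
    using assms(3) by (auto simp: dual_cone_def topological_dual_def)
  have "linear (\<lambda>z. \<phi> z / r)"
    by (rule linearI) (simp_all add: linear_add[OF lin] linear_scale[OF lin] add_divide_distrib)
  moreover have "continuous_on UNIV (\<lambda>z. \<phi> z / r)"
    using cont \<open>0 < r\<close> by (intro continuous_on_divide continuous_on_const) auto
  ultimately show "(\<lambda>z. \<phi> z / r) \<in> dual_cone C"
    using assms(3) \<open>0 < r\<close> by (auto simp: dual_cone_def topological_dual_def)
  define v where "v = real_of_ereal (primal_value f g S C)"
  have v: "primal_value f g S C = ereal v"
    using fin by (simp add: v_def ereal_real)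
  have "ereal v \<le> f x + pairing (\<lambda>z. \<phi> z / r) (g x)" if "x \<in> S" for x
  proof (cases "x \<in> edom f \<and> x \<in> bdom g")
    case True
    then obtain y where y: "g x = Elem y" by (auto simp: bdom_def)
    have "0 \<le> \<phi> y + r * (real_of_ereal (f x) - v)"
      using pos[OF _ y] True that by (simp add: v_def)
    then have "v \<le> real_of_ereal (f x) + \<phi> y / r"
      using \<open>0 < r\<close> by (simp add: field_simps)
    then show ?thesis
      using True by (subst edom_ereal[OF f]) (auto simp: y)
  next
    case False
    have "f x \<noteq> - \<infinity>" using f by (auto simp: eproper_def dest: spec[of _ x])
    with False show ?thesis
      by (cases "g x"; cases "f x") (auto simp: edom_def bdom_def)
  qed
  then show "primal_value f g S C \<le> dual_objective f g S (\<lambda>z. \<phi> z / r)"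
    unfolding dual_objective_def v by (intro INF_greatest)
qed

theorem theorem29:
  fixes f :: "'x::locally_convex_space \<Rightarrow> ereal"
    and g :: "'x \<Rightarrow> 'z::locally_convex_space bullet"
    and S :: "'x set" and C :: "'z set"
  assumes "convex_cone C"
    and "S \<noteq> {}"
    and "eproper f" and "bproper g"
    and "\<bar>primal_value f g S C\<bar> \<noteq> \<infinity>"
  shows "(convex S \<and> econvex f \<and> cone_convex C g \<longrightarrow> convexlike f g S C) \<and>
    (convexlike f g S C \<and> (RC6' f g S C \<or> RC6 f g S C \<or> RC7 f g S C) \<longrightarrow>
      primal_value f g S C = dual_value f g S C \<and> (\<exists>\<phi>. dual_solution f g S C \<phi>))"
proof (intro conjI[of "_ \<longrightarrow> _" "_ \<longrightarrow> _"] impI)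
  assume "convex S \<and> econvex f \<and> cone_convex C g"
  then show "convexlike f g S C"
    using convexlike_of_convex assms(1,3) by blast
next
  assume "convexlike f g S C \<and> (RC6' f g S C \<or> RC6 f g S C \<or> RC7 f g S C)"
  then have rc: "RC6' f g S C \<or> RC6 f g S C \<or> RC7 f g S C" ..
  then have "qri_separation f g S C"
    by (auto simp: RC6'_def RC6_def RC7_def)
  then obtain \<phi> r where \<phi>: "\<phi> \<in> dual_cone C" "0 \<le> r"
    and pos: "\<And>x y. x \<in> edom f \<inter> S \<Longrightarrow> g x = Elem y \<Longrightarrow>
      0 \<le> \<phi> y + r * (real_of_ereal (f x) - real_of_ereal (primal_value f g S C))"
    and deg: "r = 0 \<Longrightarrow> \<exists>y\<in>image_plus_cone f g S C. 0 < \<phi> y"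
    using functional_of_qri_separation[OF assms(1,5)] by metis
  have dual: "linear \<phi>" "\<phi> \<in> topological_dual" "\<And>z. z \<in> C \<Longrightarrow> 0 \<le> \<phi> z"
    using \<phi>(1) by (auto simp: dual_cone_def topological_dual_def)
  have "r \<noteq> 0"
  proof
    assume "r = 0"
    then obtain y where y: "y \<in> image_plus_cone f g S C" "0 < \<phi> y" using deg by blast
    have "0 \<le> \<phi> d" if "d \<in> image_plus_cone f g S C" for d
      using that pos dual(3) \<open>r = 0\<close>
      by (fastforce simp: image_plus_cone_def linear_add[OF dual(1)] elim!: set_plus_elim)
    from regularity_forces_functional_zero[OF rc dual(2) this y(1)] y(2)
    show False by simp
  qed
  with \<phi>(2) have "0 < r" by simp
  from multiplier_of_functional[OF assms(3,5) \<phi>(1) this pos]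
  show "primal_value f g S C = dual_value f g S C \<and> (\<exists>\<phi>. dual_solution f g S C \<phi>)"
    by (rule strong_duality_of_multiplier)
qed

end
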